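(* Let $q$ be a prime power and let $G\in\mathbb{F}_q^{3\times n}$ be a systematic MDS matrix. Suppose $n\ge 6$. Then $$\mathrm{vol}(\Lambda(G))=\frac{n^3+18n^2+54n-18}{162}.$$
   Context: A matrix $G\in\mathbb{F}_q^{k\times n}$ is systematic if its first $k$ columns form the $k\times k$ identity matrix. It is an MDS matrix if it has rank $k$ and its row space $\mathcal{C}$ has minimum Hamming distance $d$ (the minimum number of nonzero entries of a nonzero vector of $\mathcal{C}$) satisfying $k+d-1=n$; equivalently, every $k$ columns of $G$ are linearly independent over $\mathbb{F}_q$. Here $k=3$. Let $G^\nu$ denote the $\nu$-th column of $G$ and $e_i$ the $i$-th standard basis vector of $\mathbb{F}_q^k$. For $i\in\{1,\ldots,k\}$ let $\mathcal{R}_i^{\mathrm{all}}(G)=\{R\subseteq\{1,\ldots,n\}\mid e_i\in\langle G^\nu\mid\nu\in R\rangle\}$, where $\langle\cdot\rangle$ is the $\mathbb{F}_q$-span. The service rate region $\Lambda(G)\subseteq\mathbb{R}^k$ (with server capacity $1$) is the set of all $(\lambda_1,\ldots,\lambda_k)\in\mathbb{R}^k$ for which there exist real numbers $\lambda_{i,R}\ge 0$ ($i\in\{1,\ldots,k\}$, $R\in\mathcal{R}_i^{\mathrm{all}}(G)$) with $\sum_{R\in\mathcal{R}_i^{\mathrm{all}}(G)}\lambda_{i,R}=\lambda_i$ for all $i$, and $\sum_{i=1}^k\sum_{R\in\mathcal{R}_i^{\mathrm{all}}(G),\,\nu\in R}\lambda_{i,R}\le 1$ for all $\nu\in\{1,\ldots,n\}$.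 It is a convex polytope; $\mathrm{vol}$ denotes the Lebesgue measure (in $\mathbb{R}^k$) of its interior. *)

theory Defs
  imports "HOL-Analysis.Analysis" "HOL-Number_Theory.Prime_Powers"
begin

text \<open>
  A $k \times n$ matrix over \<^typ>\<open>'a\<close> is an element of \<^typ>\<open>'a ^ 'n ^ 'k\<close>.  The
  notion of ``the first $k$ columns'' needs an ordering of the index types, which is supplied by the
  class \<^class>\<open>linorder\<close>; the numeral types provide instances of every size.
  Positions are counted from 0.  Note that in the type 3 the indices in increasing order
  are 3, 1, 2, because 3 = 0 there; this only affects how the coordinates are labelled.
\<close>

definition nth_index :: "nat \<Rightarrow> 'i::{finite,linorder}" where
  "nth_index j = sorted_list_of_set UNIV ! j"

text \<open>The bound on the number of columns makes sure that there are first $k$ columns.\<close>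

definition systematic :: "'a::field ^ 'n::{finite,linorder} ^ 'k::{finite,linorder} \<Rightarrow> bool" where
  "systematic G \<longleftrightarrow> CARD('k) \<le> CARD('n) \<and>
     (\<forall>i<CARD('k). \<forall>j<CARD('k). G $ nth_index i $ nth_index j = (if i = j then 1 else 0))"

definition row_space :: "'a::field ^ 'n::finite ^ 'k::finite \<Rightarrow> ('a ^ 'n) set" where
  "row_space G = vec.span (rows G)"

definition hamming_weight :: "'a::zero ^ 'n::finite \<Rightarrow> nat" where
  "hamming_weight c = card {\<nu>. c $ \<nu> \<noteq> 0}"

text \<open>For a linear code, i.e.\ a subspace.  It is meaningful only if the code is nonzero, since
  otherwise \<^const>\<open>Min\<close> is applied to the empty set.\<close>

definition min_distance :: "('a::zero ^ 'n::finite) set \<Rightarrow> nat" where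
  "min_distance C = Min (hamming_weight ` (C - {0}))"

definition MDS_matrix :: "'a::field ^ 'n::finite ^ 'k::finite \<Rightarrow> bool" where
  "MDS_matrix G \<longleftrightarrow>
     rank G = CARD('k) \<and> CARD('k) + min_distance (row_space G) - 1 = CARD('n)"

definition recovery_sets :: "'a::field ^ 'n::finite ^ 'k::finite \<Rightarrow> 'k \<Rightarrow> 'n set set" where
  "recovery_sets G i = {R. axis i 1 \<in> vec.span ((\<lambda>\<nu>. column \<nu> G) ` R)}"

definition service_rate_region :: "'a::field ^ 'n::finite ^ 'k::finite \<Rightarrow> (real ^ 'k) set" where
  "service_rate_region G =
     {l. \<exists>a :: 'k \<Rightarrow> 'n set \<Rightarrow> real.
           (\<forall>i. \<forall>R\<in>recovery_sets G i. a i R \<ge> 0) \<and>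
           (\<forall>i. (\<Sum>R\<in>recovery_sets G i. a i R) = l $ i) \<and>
           (\<forall>\<nu>. (\<Sum>i\<in>UNIV. \<Sum>R\<in>{R \<in> recovery_sets G i. \<nu> \<in> R}. a i R) \<le> 1)}"

definition vol :: "(real ^ 'k::finite) set \<Rightarrow> real" where
  "vol S = measure lebesgue (interior S)"

end

theory Submission
  imports Defs
begin

text \<open>
  Let \<open>k\<close> be the number of rows; the geometry is the same for every \<open>k\<close> with \<open>n \<ge> 2 k\<close>.  Any
  \<open>k\<close> columns of an MDS matrix form a basis, and so a set of servers recovers the \<open>i\<close>-th object
  iff it contains the \<open>i\<close>-th systematic server or has at least \<open>k\<close> elements
  (\<open>recovery_sets_systematic_MDS\<close>).  Serving an object at rate \<open>t\<close> therefore costs total capacity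
  at least \<open>t\<close>, and at least \<open>1 + k (t - 1)\<close>, since the systematic server has capacity \<open>1\<close> and
  every other request occupies \<open>k\<close> servers.  The larger of the two bounds is \<open>server_load k t\<close>, and
  the total capacity is \<open>n\<close>, which gives the necessary condition that the loads of the rates add up to
  at most \<open>n\<close>.  Conversely this condition suffices: use every systematic server for its own object
  as far as possible, and pack the remaining capacity without loss by \<open>k\<close>-sets
  (\<open>exact_fractional_packing\<close>).  This is possible because the \<open>n - k \<ge> k\<close> other servers are still
  entirely free.  Hence the region is
  \[ \Lambda(G) = \{\lambda \ge 0 \mid \sum_i \max(\lambda_i, k \lambda_i - (k - 1)) \le n\} \]
  by \<open>service_rate_region_systematic_MDS\<close>.

  The volume of this region is computed by slicing, one coordinate at a time.  Integrating a truncated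
  power \<open>s\<^sup>m / m!\<close> along a coordinate raises its exponent, and the change of slope at rate \<open>1\<close>
  adds the same power at \<open>s - 1\<close> with factor \<open>- (1 - 1 / k)\<close>
  (\<open>has_integral_truncated_power_server_load\<close>).  Iterating this \<open>k\<close> times gives
  \[ \mathrm{vol}(\Lambda(G)) =
     \frac{1}{k!} \sum_{j \le k} {k \choose j} (-1)^j (1 - 1/k)^j (n - j)^k , \]
  where all \<open>n - j\<close> are positive.  For \<open>k = 3\<close> this is the polynomial claimed.
\<close>

section \<open>Recovery sets of systematic MDS matrices\<close>

lemma bij_betw_nth_index: "bij_betw (nth_index :: nat \<Rightarrow> 'i::{finite,linorder}) {..<CARD('i)} UNIV"
proof -
  have "nth_index = (!) (sorted_list_of_set (UNIV :: 'i set))"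
    by (auto simp: nth_index_def)
  then show ?thesis
    using bij_betw_nth[of "sorted_list_of_set (UNIV :: 'i set)"] by simp
qed

lemma systematic_unit_columns:
  fixes G :: "'a::field ^ 'n::{finite,linorder} ^ 'k::{finite,linorder}"
  assumes "systematic G"
  obtains \<sigma> :: "'k \<Rightarrow> 'n" where "inj \<sigma>" "\<And>i. column (\<sigma> i) G = axis i 1"
proof -
  define pos where "pos = inv_into {..<CARD('k)} (nth_index :: nat \<Rightarrow> 'k)"
  have pos: "pos i < CARD('k)" "nth_index (pos i) = i" for i
  proof -
    have "i \<in> nth_index ` {..<CARD('k)}"
      using bij_betw_nth_index[where 'i = 'k] by (simp add: bij_betw_def)
    then show "pos i < CARD('k)" "nth_index (pos i) = i"
      using inv_into_into[of i nth_index "{..<CARD('k)}"] by (auto simp: pos_def f_inv_into_f)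
  qed
  have col: "column (nth_index (pos i)) G = axis i 1" for i
  proof -
    have "G $ j $ nth_index (pos i) = (if j = i then 1 else 0)" for j
      using assms pos(1)[of i] pos(1)[of j] pos(2)[of i] pos(2)[of j]
      unfolding systematic_def by metis
    then show ?thesis
      by (auto simp: column_def axis_def vec_eq_iff)
  qed
  show thesis
  proof (rule that)
    show "inj (\<lambda>i. nth_index (pos i) :: 'n)"
    proof (rule injI)
      fix i j :: 'k
      assume "nth_index (pos i) = (nth_index (pos j) :: 'n)"
      then have "axis i (1::'a) = axis j 1"
        using col by metis
      then show "i = j"
        by (simp add: axis_eq_axis)
    qed
  qed (rule col)
qed

text \<open>
  A vanishing combination with a nonzero coefficient would put one row into the span of the
  remaining ones, so fewer than \<open>k\<close> vectors would span the row space.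
\<close>

lemma full_rank_rows_independent:
  fixes G :: "'a::field ^ 'n::finite ^ 'k::finite"
  assumes "rank G = CARD('k)" and "(\<Sum>i\<in>UNIV. c i *s row i G) = 0"
  shows "c i = 0"
proof (rule ccontr)
  assume "c i \<noteq> 0"
  let ?W = "(\<lambda>j. row j G) ` (UNIV - {i})"
  have "c i *s row i G = - (\<Sum>j\<in>UNIV - {i}. c j *s row j G)"
    using assms(2) by (simp add: sum.remove[of UNIV i] eq_neg_iff_add_eq_0)
  also have "\<dots> \<in> vec.span ?W"
    by (intro vec.span_neg vec.span_sum vec.span_scale vec.span_base) auto
  finally have "inverse (c i) *s (c i *s row i G) \<in> vec.span ?W"
    by (rule vec.span_scale)
  with \<open>c i \<noteq> 0\<close> have "row i G \<in> vec.span ?W"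
    by simp
  then have "rows G \<subseteq> vec.span ?W"
    unfolding rows_def by (auto intro: vec.span_base)
  then have "vec.dim (rows G) \<le> card ?W"
    by (intro vec.dim_le_card) auto
  also have "\<dots> \<le> card (UNIV - {i})"
    by (intro card_image_le) auto
  also have "\<dots> < CARD('k)"
    by (simp add: card_Diff_singleton)
  finally show False
    using assms(1) by (simp add: row_rank_def_gen)
qed

text \<open>
  This translates the metric definition of an MDS matrix into linear algebra.  If \<open>k\<close> columns
  failed to span, a nonzero functional on the column space would vanish on them.  Its coefficients
  combine the rows into a codeword that is zero at these \<open>k\<close> positions, hence of weight at most
  \<open>n - k\<close>, which is smaller than the minimum distance \<open>n - k + 1\<close>.
\<close>

lemma MDS_columns_span:
  fixes G :: "'a::field ^ 'n::finite ^ 'k::finite"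
  assumes "MDS_matrix G" and "CARD('k) \<le> card R"
  shows "vec.span ((\<lambda>\<nu>. column \<nu> G) ` R) = UNIV"
proof (rule ccontr)
  assume proper: "vec.span ((\<lambda>\<nu>. column \<nu> G) ` R) \<noteq> UNIV"
  obtain f :: "'k \<Rightarrow> 'n" where f: "inj f" "range f \<subseteq> R"
    using card_le_inj[of "UNIV :: 'k set" R] assms(2) by auto
  \<comment> \<open>For \<open>k\<close> of the columns, taken as a square matrix, not spanning means dependent rows.\<close>
  define A :: "'a ^ 'k ^ 'k" where "A = (\<chi> i j. G $ i $ f j)"
  have "columns A \<subseteq> (\<lambda>\<nu>. column \<nu> G) ` R"
    using f(2) by (force simp: columns_def column_def A_def)
  then have "vec.span (columns A) \<noteq> UNIV"
    using proper vec.span_mono by blast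
  then have "\<not> (\<exists>B :: 'a ^ 'k ^ 'k. A ** B = mat 1)"
    by (simp only: matrix_right_invertible_span_columns not_False_eq_True)
  then obtain c i where c: "(\<Sum>i\<in>UNIV. c i *s row i A) = 0" "c i \<noteq> 0"
    unfolding matrix_right_invertible_independent_rows by blast
  define v where "v = (\<Sum>i\<in>UNIV. c i *s row i G)"
  have "v \<noteq> 0"
    using full_rank_rows_independent[of G c i] assms(1) c(2)
    by (auto simp: MDS_matrix_def v_def)
  have "v \<in> row_space G"
    unfolding v_def row_space_def
    by (intro vec.span_sum vec.span_scale vec.span_base) (auto simp: rows_def)
  have "v $ f j = (\<Sum>i\<in>UNIV. c i *s row i A) $ j" for j
    by (simp add: v_def row_def A_def)
  then have "{\<nu>. v $ \<nu> \<noteq> 0} \<subseteq> UNIV - range f"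
    using c(1) by auto
  then have "hamming_weight v \<le> card (UNIV - range f)"
    unfolding hamming_weight_def by (intro card_mono) auto
  also have "\<dots> = CARD('n) - CARD('k)"
    using f(1) by (simp add: card_Diff_subset card_image)
  finally have weight: "hamming_weight v \<le> CARD('n) - CARD('k)" .
  have "finite (hamming_weight ` (row_space G - {0}))"
    by (rule finite_subset[of _ "{..CARD('n)}"]) (auto simp: hamming_weight_def card_mono)
  then have "min_distance (row_space G) \<le> hamming_weight v"
    unfolding min_distance_def
    using \<open>v \<noteq> 0\<close> \<open>v \<in> row_space G\<close> by (intro Min_le) auto
  moreover have "CARD('k) \<le> CARD('n)"
    using assms(2) card_mono[of UNIV R] by simp
  moreover have "CARD('k) + min_distance (row_space G) - 1 = CARD('n)"
    using assms(1) by (simp add: MDS_matrix_def)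
  moreover have "CARD('n) > 0"
    by simp
  ultimately show False
    using weight by linarith
qed

text \<open>
  Fewer than \<open>k\<close> columns, none of them \<open>e\<^sub>i\<close>, cannot generate \<open>e\<^sub>i\<close>: together with the column
  \<open>e\<^sub>i\<close> they extend to \<open>k\<close> columns, which form a basis.  So the only economical recovery
  sets are the systematic server on its own and the sets of \<open>k\<close> servers.
\<close>

lemma recovery_sets_systematic_MDS:
  fixes G :: "'a::field ^ 'n::finite ^ 'k::finite"
  assumes "MDS_matrix G" and "CARD('k) \<le> CARD('n)" and "column \<nu> G = axis i 1"
  shows "recovery_sets G i = {R. \<nu> \<in> R \<or> CARD('k) \<le> card R}"
proof -
  let ?col = "\<lambda>\<mu>. column \<mu> G"
  have "R \<in> recovery_sets G i \<longleftrightarrow> \<nu> \<in> R \<or> CARD('k) \<le> card R" for R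
  proof (cases "\<nu> \<in> R \<or> CARD('k) \<le> card R")
    case True
    then have "axis i 1 \<in> vec.span (?col ` R)"
    proof
      assume "\<nu> \<in> R"
      then have "?col \<nu> \<in> vec.span (?col ` R)"
        by (intro vec.span_base) auto
      then show ?thesis
        using assms(3) by simp
    qed (simp add: MDS_columns_span[OF assms(1)])
    with True show ?thesis
      by (simp add: recovery_sets_def)
  next
    case False
    have "card (insert \<nu> R) \<le> CARD('k)"
      using False by simp
    then obtain B where B: "insert \<nu> R \<subseteq> B" "card B = CARD('k)"
      using exists_subset_between[of "insert \<nu> R" "CARD('k)" UNIV] assms(2) by auto
    have "axis i 1 \<notin> vec.span (?col ` R)"
    proof
      assume "axis i 1 \<in> vec.span (?col ` R)"
      also have "\<dots> \<subseteq> vec.span (?col ` (B - {\<nu>}))"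
        using B(1) False by (intro vec.span_mono) auto
      finally have "?col \<nu> \<in> vec.span (?col ` (B - {\<nu>}))"
        using assms(3) by simp
      then have "?col ` B \<subseteq> vec.span (?col ` (B - {\<nu>}))"
        by (auto intro: vec.span_base)
      then have "vec.span (?col ` B) \<subseteq> vec.span (?col ` (B - {\<nu>}))"
        by (intro vec.span_minimal vec.subspace_span)
      then have "UNIV \<subseteq> vec.span (?col ` (B - {\<nu>}))"
        using MDS_columns_span[OF assms(1)] B(2) by simp
      then have "vec.dim (UNIV :: ('a ^ 'k) set) \<le> card (?col ` (B - {\<nu>}))"
        by (intro vec.dim_le_card) auto
      also have "\<dots> \<le> card (B - {\<nu>})"
        by (intro card_image_le) auto
      also have "\<dots> < CARD('k)"
        using B by (simp add: card_Diff_singleton)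
      finally show False
        by (simp only: vec_dim_card less_irrefl)
    qed
    with False show ?thesis
      by (simp add: recovery_sets_def)
  qed
  then show ?thesis
    by blast
qed

section \<open>Packing sets of fixed size into capacities\<close>

lemma card_subsets_containing:
  assumes "finite P" and "\<nu> \<in> P" and "0 < k"
  shows "card {R. R \<subseteq> P \<and> card R = k \<and> \<nu> \<in> R} = (card P - 1) choose (k - 1)"
proof -
  let ?S = "{S. S \<subseteq> P - {\<nu>} \<and> card S = k - 1}"
  have fin: "finite R" if "R \<subseteq> P" for R
    using that assms(1) finite_subset by blast
  have "{R. R \<subseteq> P \<and> card R = k \<and> \<nu> \<in> R} = insert \<nu> ` ?S"
  proof (intro set_eqI iffI)
    fix R assume R: "R \<in> {R. R \<subseteq> P \<and> card R = k \<and> \<nu> \<in> R}"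
    then have "R = insert \<nu> (R - {\<nu>})" "R - {\<nu>} \<in> ?S"
      using fin[of R] by (auto simp: card_Diff_singleton)
    then show "R \<in> insert \<nu> ` ?S"
      by blast
  next
    fix R assume "R \<in> insert \<nu> ` ?S"
    then obtain S where S: "R = insert \<nu> S" "S \<subseteq> P - {\<nu>}" "card S = k - 1"
      by auto
    then have "card R = k"
      using fin[of S] assms(3) by (subst S(1), subst card_insert_disjoint) auto
    with S assms(2) show "R \<in> {R. R \<subseteq> P \<and> card R = k \<and> \<nu> \<in> R}"
      by auto
  qed
  moreover have "inj_on (insert \<nu>) ?S"
    by (rule inj_onI) (auto simp: insert_ident)
  ultimately show ?thesis
    using assms n_subsets[of "P - {\<nu>}" "k - 1"] by (simp add: card_image card_Diff_singleton)
qed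

text \<open>
  When every capacity is
  \<open>0\<close> or \<open>1\<close>, the uniform weight on the \<open>k\<close>-subsets of the servers with capacity \<open>1\<close> uses
  them up exactly, by symmetry.  A fractional capacity \<open>c\<close> is the average of \<open>1\<close> and \<open>0\<close> with weights \<open>c\<close> and
  \<open>1 - c\<close>, and the packings for these two values may be averaged likewise, so the claim follows by
  induction on the number of fractional capacities.  Having \<open>k\<close> servers of capacity \<open>1\<close> guarantees
  that the uniform weight exists in every case that arises.
\<close>

lemma exact_fractional_packing:
  fixes c :: "'n::finite \<Rightarrow> real"
  assumes "0 < k" and "k \<le> card {\<nu>. c \<nu> = 1}" and "\<And>\<nu>. 0 \<le> c \<nu> \<and> c \<nu> \<le> 1"
  shows "\<exists>w. (\<forall>R. 0 \<le> w R) \<and> (\<forall>\<nu>. (\<Sum>R | card R = k \<and> \<nu> \<in> R. w R) = c \<nu>)"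
  using assms(2,3)
proof (induction "card {\<nu>. c \<nu> \<noteq> 0 \<and> c \<nu> \<noteq> 1}" arbitrary: c rule: less_induct)
  case less
  show ?case
  proof (cases "\<exists>\<mu>. c \<mu> \<noteq> 0 \<and> c \<mu> \<noteq> 1")
    case True
    then obtain \<mu> where \<mu>: "c \<mu> \<noteq> 0" "c \<mu> \<noteq> 1"
      by auto
    have step: "\<exists>w. (\<forall>R. 0 \<le> w R) \<and> (\<forall>\<nu>. (\<Sum>R | card R = k \<and> \<nu> \<in> R. w R) = (c(\<mu> := b)) \<nu>)"
      if "b \<in> {0, 1}" for b
    proof (rule less.hyps)
      show "card {\<nu>. (c(\<mu> := b)) \<nu> \<noteq> 0 \<and> (c(\<mu> := b)) \<nu> \<noteq> 1} < card {\<nu>. c \<nu> \<noteq> 0 \<and> c \<nu> \<noteq> 1}"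
        using \<mu> that by (intro psubset_card_mono) auto
      have "card {\<nu>. c \<nu> = 1} \<le> card {\<nu>. (c(\<mu> := b)) \<nu> = 1}"
        using \<mu> by (intro card_mono) auto
      with less.prems(1) show "k \<le> card {\<nu>. (c(\<mu> := b)) \<nu> = 1}"
        by linarith
      show "0 \<le> (c(\<mu> := b)) \<nu> \<and> (c(\<mu> := b)) \<nu> \<le> 1" for \<nu>
        using less.prems(2) that by auto
    qed
    obtain u where u: "\<And>R. 0 \<le> u R"
      "\<And>\<nu>. (\<Sum>R | card R = k \<and> \<nu> \<in> R. u R) = (c(\<mu> := 0)) \<nu>"
      using step[of 0] by auto
    obtain v where v: "\<And>R. 0 \<le> v R"
      "\<And>\<nu>. (\<Sum>R | card R = k \<and> \<nu> \<in> R. v R) = (c(\<mu> := 1)) \<nu>"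
      using step[of 1] by auto
    let ?w = "\<lambda>R. (1 - c \<mu>) * u R + c \<mu> * v R"
    have "0 \<le> ?w R" for R
      using u(1) v(1) less.prems(2)[of \<mu>] by auto
    moreover have "(\<Sum>R | card R = k \<and> \<nu> \<in> R. ?w R) = c \<nu>" for \<nu>
      unfolding sum.distrib sum_distrib_left[symmetric] u(2) v(2) by (simp add: algebra_simps)
    ultimately show ?thesis
      by (intro exI[of _ ?w]) blast
  next
    case False
    define P where "P = {\<nu>. c \<nu> = 1}"
    \<comment> \<open>The number of \<open>k\<close>-subsets of \<open>P\<close> through a given point of \<open>P\<close>.\<close>
    define N where "N = (card P - 1) choose (k - 1)"
    have "N > 0"
      using less.prems(1) by (simp add: N_def P_def)
    let ?w = "\<lambda>R. if R \<subseteq> P then 1 / real N else 0"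
    have "(\<Sum>R | card R = k \<and> \<nu> \<in> R. ?w R) = c \<nu>" for \<nu>
    proof -
      have "(\<Sum>R | card R = k \<and> \<nu> \<in> R. ?w R)
          = (\<Sum>R | card R = k \<and> \<nu> \<in> R \<and> R \<subseteq> P. 1 / real N)"
        by (intro sum.mono_neutral_cong_right) auto
      also have "\<dots> = real (card {R. R \<subseteq> P \<and> card R = k \<and> \<nu> \<in> R}) / real N"
        by (simp add: conj_ac)
      also have "\<dots> = c \<nu>"
      proof (cases "\<nu> \<in> P")
        case True
        then have "card {R. R \<subseteq> P \<and> card R = k \<and> \<nu> \<in> R} = N"
          unfolding N_def using assms(1) by (intro card_subsets_containing) auto
        with True \<open>N > 0\<close> show ?thesis
          by (simp add: P_def)
      next
        assume nP: "\<nu> \<notin> P"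
        then have "{R. R \<subseteq> P \<and> card R = k \<and> \<nu> \<in> R} = {}"
          by auto
        moreover have "c \<nu> = 0"
          using nP False by (auto simp: P_def)
        ultimately show ?thesis
          by (simp only: card.empty of_nat_0 div_0)
      qed
      finally show ?thesis .
    qed
    then show ?thesis
      by (intro exI[of _ ?w]) auto
  qed
qed

section \<open>The service rate region\<close>

text \<open>
  The least total capacity that a request rate \<open>t\<close> for one object consumes: up to rate \<open>1\<close> the
  systematic server of the object is charged once per unit, and beyond that each unit charges \<open>k\<close>
  servers.  Taking the maximum of the two affine pieces makes convexity evident.
\<close>

definition server_load :: "real \<Rightarrow> real \<Rightarrow> real" where
  "server_load k t = max t (k * t - (k - 1))"

lemma sum_of_loads:
  fixes a :: "'n::finite set \<Rightarrow> real"
  shows "(\<Sum>\<nu>\<in>UNIV. \<Sum>R\<in>{R \<in> F. \<nu> \<in> R}. a R) = (\<Sum>R\<in>F. real (card R) * a R)"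
proof -
  have "(\<Sum>\<nu>\<in>UNIV. \<Sum>R\<in>{R \<in> F. \<nu> \<in> R}. a R) = (\<Sum>R\<in>F. \<Sum>\<nu> | \<nu> \<in> UNIV \<and> \<nu> \<in> R. a R)"
    by (intro sum.swap_restrict) auto
  then show ?thesis
    by simp
qed

text \<open>
  The necessary condition for a single object.  If \<open>b\<close> is the weight of the sets that contain
  the systematic server \<open>s\<close> and \<open>d\<close> that of the others, then the load is at least \<open>b + k d\<close>.
  Under \<open>b \<le> 1\<close> and \<open>d \<ge> 0\<close> this is at least both affine pieces of \<^const>\<open>server_load\<close> at
  \<open>b + d\<close>.
\<close>

lemma server_load_le_total_load:
  fixes a :: "'n::finite set \<Rightarrow> real"
  assumes F: "F = {R. s \<in> R \<or> k \<le> card R}" and "1 \<le> k"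
    and nonneg: "\<And>R. R \<in> F \<Longrightarrow> 0 \<le> a R"
    and cap: "(\<Sum>R\<in>{R \<in> F. s \<in> R}. a R) \<le> 1"
  shows "server_load (real k) (\<Sum>R\<in>F. a R) \<le> (\<Sum>\<nu>\<in>UNIV. \<Sum>R\<in>{R \<in> F. \<nu> \<in> R}. a R)"
proof -
  define b where "b = (\<Sum>R\<in>{R \<in> F. s \<in> R}. a R)"
  define d where "d = (\<Sum>R\<in>{R \<in> F. s \<notin> R}. a R)"
  have split: "(\<Sum>R\<in>F. h R) = (\<Sum>R\<in>{R \<in> F. s \<in> R}. h R) + (\<Sum>R\<in>{R \<in> F. s \<notin> R}. h R)"
    for h :: "'n set \<Rightarrow> real"
    by (subst sum.union_disjoint[symmetric]) (auto intro: sum.cong)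
  have "0 \<le> d"
    unfolding d_def by (intro sum_nonneg) (auto intro: nonneg)
  have "b \<le> (\<Sum>R\<in>{R \<in> F. s \<in> R}. real (card R) * a R)"
    unfolding b_def
  proof (rule sum_mono)
    fix R assume R: "R \<in> {R \<in> F. s \<in> R}"
    then have "1 \<le> card R"
      by (auto simp: Suc_le_eq card_gt_0_iff)
    then have "1 * a R \<le> real (card R) * a R"
      using R by (intro mult_right_mono nonneg) auto
    then show "a R \<le> real (card R) * a R"
      by simp
  qed
  moreover have "real k * d \<le> (\<Sum>R\<in>{R \<in> F. s \<notin> R}. real (card R) * a R)"
    unfolding d_def sum_distrib_left
    by (intro sum_mono mult_right_mono nonneg) (auto simp: F)
  ultimately have "b + real k * d \<le> (\<Sum>R\<in>F. real (card R) * a R)"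
    using split[of "\<lambda>R. real (card R) * a R"] by linarith
  moreover have "server_load (real k) (b + d) \<le> b + real k * d"
  proof -
    have "1 * d \<le> real k * d" "(real k - 1) * b \<le> (real k - 1) * 1"
      using \<open>0 \<le> d\<close> cap assms(2) by (intro mult_right_mono mult_left_mono; simp add: b_def)+
    then show ?thesis
      by (simp add: server_load_def algebra_simps)
  qed
  ultimately show ?thesis
    using split[of a] by (simp add: sum_of_loads b_def d_def)
qed

text \<open>
  The converse.  Every object is served at rate \<open>x i = min (l i) 1\<close> by its systematic server.  The
  capacity left over is packed exactly by \<open>k\<close>-sets of total weight \<open>W\<close>; here \<open>n \<ge> 2 k\<close> provides
  the \<open>k\<close> untouched servers that the packing asks for.  The unserved demand \<open>D\<close> satisfies
  \<open>D \<le> W\<close> by the bound on the load, and so the packing, scaled by \<open>D / W\<close>, can be divided among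
  the objects in proportion to their unserved rates.  All \<open>k\<close>-sets recover all objects, so it does
  not matter which of them goes to which object.
\<close>

lemma achievable_if_load_le:
  fixes \<sigma> :: "'k::finite \<Rightarrow> 'n::finite" and l :: "'k \<Rightarrow> real"
  assumes "inj \<sigma>" and n: "2 * CARD('k) \<le> CARD('n)"
    and F: "\<And>i. F i = {R. \<sigma> i \<in> R \<or> CARD('k) \<le> card R}"
    and nonneg: "\<And>i. 0 \<le> l i"
    and load: "(\<Sum>i\<in>UNIV. server_load CARD('k) (l i)) \<le> CARD('n)"
  shows "\<exists>a. (\<forall>i. \<forall>R\<in>F i. 0 \<le> a i R) \<and> (\<forall>i. (\<Sum>R\<in>F i. a i R) = l i) \<and>
             (\<forall>\<nu>. (\<Sum>i\<in>UNIV. \<Sum>R\<in>{R \<in> F i. \<nu> \<in> R}. a i R) \<le> 1)"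
proof -
  define k where "k = CARD('k)"
  have k: "0 < k" "real k > 0"
    by (simp_all add: k_def)
  define x where "x i = min (l i) 1" for i
  define used where "used \<nu> = (\<Sum>i\<in>UNIV. if \<nu> = \<sigma> i then x i else 0)" for \<nu>
  have x: "0 \<le> x i" "x i \<le> 1" "x i \<le> l i" for i
    using nonneg[of i] by (auto simp: x_def)
  have used_sys: "used (\<sigma> i) = x i" for i
  proof -
    have "used (\<sigma> i) = (\<Sum>j\<in>UNIV. if i = j then x j else 0)"
      unfolding used_def using \<open>inj \<sigma>\<close> by (simp add: inj_eq)
    then show ?thesis
      by simp
  qed
  have used_other: "used \<nu> = 0" if "\<nu> \<notin> range \<sigma>" for \<nu>
    unfolding used_def using that by (intro sum.neutral) auto
  have used: "0 \<le> used \<nu>" "used \<nu> \<le> 1" for \<nu>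
    by (cases "\<nu> \<in> range \<sigma>"; use x used_sys used_other in force)+
  have "card (UNIV - range \<sigma>) \<le> card {\<nu>. 1 - used \<nu> = 1}"
    using used_other by (intro card_mono) auto
  moreover have "card (UNIV - range \<sigma>) = CARD('n) - k"
    using \<open>inj \<sigma>\<close> by (simp add: card_Diff_subset card_image k_def)
  ultimately have "k \<le> card {\<nu>. 1 - used \<nu> = 1}"
    using n by (simp add: k_def)
  then obtain w where w: "\<And>R. 0 \<le> w R"
      "\<And>\<nu>. (\<Sum>R | card R = k \<and> \<nu> \<in> R. w R) = 1 - used \<nu>"
    using exact_fractional_packing[of k "\<lambda>\<nu>. 1 - used \<nu>"] k(1) used by auto
  define W where "W = (\<Sum>R | card R = k. w R)"
  define D where "D = (\<Sum>i\<in>UNIV. l i - x i)"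
  have "(\<Sum>\<nu>\<in>UNIV. used \<nu>) = (\<Sum>i\<in>UNIV. x i)"
    unfolding used_def by (subst sum.swap) simp
  \<comment> \<open>Every \<open>k\<close>-set loads \<open>k\<close> servers, so the capacity used up is \<open>k W\<close>.\<close>
  moreover have "real k * W = (\<Sum>\<nu>\<in>UNIV. 1 - used \<nu>)"
  proof -
    have "real k * W = (\<Sum>R | card R = k. real (card R) * w R)"
      by (simp add: W_def sum_distrib_left)
    also have "\<dots> = (\<Sum>\<nu>\<in>UNIV. \<Sum>R\<in>{R \<in> {R. card R = k}. \<nu> \<in> R}. w R)"
      by (rule sum_of_loads[symmetric])
    finally show ?thesis
      by (simp add: w(2))
  qed
  ultimately have kW: "real k * W = CARD('n) - (\<Sum>i\<in>UNIV. x i)"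
    by (simp add: sum_subtractf)
  have "(\<Sum>i\<in>UNIV. x i) \<le> real k"
    using sum_mono[of UNIV x "\<lambda>_. 1"] x(2) by (simp add: k_def)
  moreover have "real k < real CARD('n)"
    using n k unfolding k_def by linarith
  ultimately have "real k * W > 0"
    using kW by linarith
  then have "W > 0"
    using k zero_less_mult_pos by blast
  have "(\<Sum>i\<in>UNIV. server_load k (l i)) = (\<Sum>i\<in>UNIV. x i + real k * (l i - x i))"
  proof (rule sum.cong)
    fix i
    have "1 \<le> real k"
      using k by simp
    show "server_load (real k) (l i) = x i + real k * (l i - x i)"
    proof (cases "l i \<le> 1")
      case True
      then have "0 \<le> (real k - 1) * (1 - l i)"
        using \<open>1 \<le> real k\<close> by simp
      with True show ?thesis
        by (simp add: server_load_def x_def algebra_simps)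
    next
      case False
      then have "0 \<le> (real k - 1) * (l i - 1)"
        using \<open>1 \<le> real k\<close> by simp
      with False show ?thesis
        by (simp add: server_load_def x_def algebra_simps)
    qed
  qed simp
  also have "\<dots> = (\<Sum>i\<in>UNIV. x i) + real k * D"
    by (simp add: D_def sum.distrib sum_distrib_left)
  finally have "real k * D \<le> real k * W"
    using load kW by (simp add: k_def)
  then have "D \<le> W"
    using k by simp
  define a where "a i R = (if R = {\<sigma> i} then x i else 0)
      + (if card R = k then (l i - x i) / W * w R else 0)" for i R
  have "0 \<le> a i R" for i R
    using x w(1) \<open>W > 0\<close> by (simp add: a_def)
  moreover have "(\<Sum>R\<in>F i. a i R) = l i" for i
  proof -
    have "(\<Sum>R\<in>F i. a i R) = x i + (\<Sum>R\<in>F i. if card R = k then (l i - x i) / W * w R else 0)"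
      by (simp add: a_def sum.distrib F)
    also have "(\<Sum>R\<in>F i. if card R = k then (l i - x i) / W * w R else 0)
        = (\<Sum>R | card R = k. (l i - x i) / W * w R)"
      by (intro sum.mono_neutral_cong_right) (auto simp: F k_def)
    also have "\<dots> = l i - x i"
      unfolding sum_distrib_left[symmetric] W_def[symmetric] using \<open>W > 0\<close> by simp
    finally show ?thesis
      by simp
  qed
  moreover have "(\<Sum>i\<in>UNIV. \<Sum>R\<in>{R \<in> F i. \<nu> \<in> R}. a i R) \<le> 1" for \<nu>
  proof -
    have single: "(\<Sum>R\<in>{R \<in> F i. \<nu> \<in> R}. if R = {\<sigma> i} then x i else 0)
        = (if \<nu> = \<sigma> i then x i else 0)" for i
      by (subst sum.delta) (auto simp: F)
    have multi: "(\<Sum>R\<in>{R \<in> F i. \<nu> \<in> R}. if card R = k then (l i - x i) / W * w R else 0)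
        = (l i - x i) / W * (1 - used \<nu>)" for i
    proof -
      have "(\<Sum>R\<in>{R \<in> F i. \<nu> \<in> R}. if card R = k then (l i - x i) / W * w R else 0)
          = (\<Sum>R | card R = k \<and> \<nu> \<in> R. (l i - x i) / W * w R)"
        by (intro sum.mono_neutral_cong_right) (auto simp: F k_def)
      then show ?thesis
        by (simp only: sum_distrib_left[symmetric] w(2))
    qed
    have "(\<Sum>i\<in>UNIV. \<Sum>R\<in>{R \<in> F i. \<nu> \<in> R}. a i R)
        = used \<nu> + (\<Sum>i\<in>UNIV. (l i - x i) / W * (1 - used \<nu>))"
      by (simp only: a_def sum.distrib single multi used_def)
    also have "\<dots> = used \<nu> + D / W * (1 - used \<nu>)"
      by (simp add: D_def sum_distrib_right sum_divide_distrib)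
    also have "\<dots> \<le> used \<nu> + 1 * (1 - used \<nu>)"
      using \<open>D \<le> W\<close> \<open>W > 0\<close> used by (intro add_left_mono mult_right_mono) auto
    finally show ?thesis
      by simp
  qed
  ultimately show ?thesis
    by blast
qed

theorem service_rate_region_systematic_MDS:
  fixes G :: "'a::field ^ 'n::{finite,linorder} ^ 'k::{finite,linorder}"
  assumes "systematic G" and "MDS_matrix G" and n: "2 * CARD('k) \<le> CARD('n)"
  shows "service_rate_region G =
    {l. (\<forall>i. 0 \<le> l $ i) \<and> (\<Sum>i\<in>UNIV. server_load CARD('k) (l $ i)) \<le> CARD('n)}"
proof -
  obtain \<sigma> :: "'k \<Rightarrow> 'n" where \<sigma>: "inj \<sigma>" "\<And>i. column (\<sigma> i) G = axis i 1"
    using systematic_unit_columns[OF assms(1)] by metis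
  have F: "recovery_sets G i = {R. \<sigma> i \<in> R \<or> CARD('k) \<le> card R}" for i
    using recovery_sets_systematic_MDS[OF assms(2) _ \<sigma>(2)] n by simp
  show ?thesis
  proof (intro set_eqI iffI)
    fix l :: "(real, 'k) vec"
    assume "l \<in> service_rate_region G"
    then obtain a :: "'k \<Rightarrow> 'n set \<Rightarrow> real"
      where nonneg: "\<And>i R. R \<in> recovery_sets G i \<Longrightarrow> 0 \<le> a i R"
        and rate: "\<And>i. (\<Sum>R\<in>recovery_sets G i. a i R) = l $ i"
        and cap: "\<And>\<nu>. (\<Sum>i\<in>UNIV. \<Sum>R\<in>{R \<in> recovery_sets G i. \<nu> \<in> R}. a i R) \<le> 1"
      unfolding service_rate_region_def by auto
    \<comment> \<open>On its own systematic server, one object takes at most what all objects take together.\<close>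
    have own: "(\<Sum>R\<in>{R \<in> recovery_sets G i. \<sigma> i \<in> R}. a i R) \<le> 1" for i
    proof -
      have "(\<Sum>R\<in>{R \<in> recovery_sets G i. \<sigma> i \<in> R}. a i R)
          \<le> (\<Sum>j\<in>UNIV. \<Sum>R\<in>{R \<in> recovery_sets G j. \<sigma> i \<in> R}. a j R)"
        by (rule member_le_sum[where f = "\<lambda>j. \<Sum>R\<in>{R \<in> recovery_sets G j. \<sigma> i \<in> R}. a j R"])
          (auto intro!: sum_nonneg nonneg)
      then show ?thesis
        using cap by (rule order_trans)
    qed
    have "(\<Sum>i\<in>UNIV. server_load CARD('k) (l $ i))
        \<le> (\<Sum>i\<in>UNIV. \<Sum>\<nu>\<in>UNIV. \<Sum>R\<in>{R \<in> recovery_sets G i. \<nu> \<in> R}. a i R)"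
      unfolding rate[symmetric]
      by (intro sum_mono server_load_le_total_load[OF F]) (auto intro: nonneg own)
    also have "\<dots> = (\<Sum>\<nu>\<in>UNIV. \<Sum>i\<in>UNIV. \<Sum>R\<in>{R \<in> recovery_sets G i. \<nu> \<in> R}. a i R)"
      by (rule sum.swap)
    also have "\<dots> \<le> (\<Sum>\<nu>\<in>(UNIV :: 'n set). 1)"
      by (intro sum_mono cap)
    finally have "(\<Sum>i\<in>UNIV. server_load CARD('k) (l $ i)) \<le> CARD('n)"
      by simp
    moreover have "0 \<le> l $ i" for i
      unfolding rate[symmetric] by (intro sum_nonneg nonneg)
    ultimately show "l \<in> {l. (\<forall>i. 0 \<le> l $ i) \<and>
        (\<Sum>i\<in>UNIV. server_load CARD('k) (l $ i)) \<le> CARD('n)}"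
      by simp
  next
    fix l :: "(real, 'k) vec"
    assume "l \<in> {l. (\<forall>i. 0 \<le> l $ i) \<and> (\<Sum>i\<in>UNIV. server_load CARD('k) (l $ i)) \<le> CARD('n)}"
    then show "l \<in> service_rate_region G"
      unfolding service_rate_region_def
      using achievable_if_load_le[OF \<sigma>(1) n F, of "($) l"] by simp
  qed
qed

section \<open>The volume of a region of bounded load\<close>

text \<open>
  The volume of the standard simplex scaled by \<open>s\<close>, in dimension \<open>m\<close>.  In dimension \<open>0\<close> it is the
  indicator of \<open>s \<ge> 0\<close>, whereas \<open>max 0 s ^ m / fact m\<close> would be \<open>1\<close> for negative \<open>s\<close> too.
\<close>

definition truncated_power :: "nat \<Rightarrow> real \<Rightarrow> real" where
  "truncated_power m s = (if 0 \<le> s then s ^ m / fact m else 0)"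

lemma has_integral_truncated_power:
  assumes "0 < c"
  shows "has_bochner_integral lborel (\<lambda>t. indicator {a..} t * truncated_power m (s - c * t))
           (truncated_power (Suc m) (s - c * a) / c)"
proof (cases "c * a \<le> s")
  case True
  let ?f = "\<lambda>t. (s - c * t) ^ m / fact m"
  let ?F = "\<lambda>t. - ((s - c * t) ^ Suc m / (c * fact (Suc m)))"
  \<comment> \<open>The integrand vanishes beyond \<open>t = s / c\<close>.\<close>
  have "a \<le> s / c"
    using True assms by (simp add: field_simps)
  have "has_bochner_integral lborel (\<lambda>t. ?f t * indicator {a..s / c} t) (?F (s / c) - ?F a)"
  proof (rule has_bochner_integral_FTC_Icc_real)
    fix t
    show "DERIV ?F t :> ?f t"
    proof -
      have "DERIV (\<lambda>t. (s - c * t) ^ Suc m) t :> real (Suc m) * (s - c * t) ^ m * (- c)"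
        by (auto intro!: derivative_eq_intros simp del: power_Suc of_nat_Suc)
      from DERIV_cmult[OF this, of "- 1 / (c * fact (Suc m))"] show ?thesis
        using assms by (simp add: divide_simps del: power_Suc of_nat_Suc)
    qed
    show "isCont ?f t"
      by (intro continuous_intros) auto
  qed fact
  also have "?F (s / c) - ?F a = truncated_power (Suc m) (s - c * a) / c"
    using True assms by (simp add: truncated_power_def)
  also have "(\<lambda>t. ?f t * indicator {a..s / c} t)
      = (\<lambda>t. indicator {a..} t * truncated_power m (s - c * t))"
    using assms by (auto simp: fun_eq_iff indicator_def truncated_power_def field_simps)
  finally show ?thesis .
next
  case False
  have above: "s < c * t" if "a \<le> t" for t
    using False mult_left_mono[OF that, of c] assms by linarith
  have zero: "(\<lambda>t. indicator {a..} t * truncated_power m (s - c * t)) = (\<lambda>_. 0)"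
  proof -
    have "indicator {a..} t * truncated_power m (s - c * t) = 0" for t
      using above[of t] by (auto simp: indicator_def truncated_power_def)
    then show ?thesis
      by blast
  qed
  show ?thesis
    unfolding zero using False by (simp add: truncated_power_def has_bochner_integral_zero)
qed

text \<open>
  The integrand agrees with the slope-\<open>1\<close> integrand on \<open>[0, 1)\<close> and with the slope-\<open>k\<close> one on
  \<open>[1, \<infinity>)\<close>.  Writing the first part as a difference of two half-lines leaves only integrals of the
  previous kind, and the break point contributes the terms at \<open>s - 1\<close> with the factors \<open>-1\<close> and
  \<open>1 / k\<close>.
\<close>

lemma has_integral_truncated_power_server_load:
  assumes "1 \<le> k"
  shows "has_bochner_integral lborel
           (\<lambda>t. indicator {0..} t * truncated_power m (s - server_load k t))
           (truncated_power (Suc m) s - (1 - 1 / k) * truncated_power (Suc m) (s - 1))"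
proof -
  let ?p = "truncated_power m" and ?q = "truncated_power (Suc m)"
  have "has_bochner_integral lborel
      (\<lambda>t. indicator {0..} t * ?p (s - 1 * t) - indicator {1..} t * ?p (s - 1 * t)
         + indicator {1..} t * ?p ((s + (k - 1)) - k * t))
      (?q (s - 1 * 0) / 1 - ?q (s - 1 * 1) / 1 + ?q ((s + (k - 1)) - k * 1) / k)"
    using assms
    by (intro has_bochner_integral_add has_bochner_integral_diff has_integral_truncated_power) auto
  also have "(\<lambda>t. indicator {0..} t * ?p (s - 1 * t) - indicator {1..} t * ?p (s - 1 * t)
         + indicator {1..} t * ?p ((s + (k - 1)) - k * t))
      = (\<lambda>t. indicator {0..} t * ?p (s - server_load k t))"
  proof
    fix t :: real
    have "0 \<le> (k - 1) * (t - 1)" if "1 \<le> t"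
      using assms that by simp
    moreover have "0 \<le> (k - 1) * (1 - t)" if "t \<le> 1"
      using assms that by simp
    ultimately have "server_load k t = (if 1 \<le> t then k * t - (k - 1) else t)"
      by (auto simp: server_load_def algebra_simps)
    then show "indicator {0..} t * ?p (s - 1 * t) - indicator {1..} t * ?p (s - 1 * t)
         + indicator {1..} t * ?p ((s + (k - 1)) - k * t)
      = indicator {0..} t * ?p (s - server_load k t)"
      by (auto simp: indicator_def algebra_simps)
  qed
  also have "?q (s - 1 * 0) / 1 - ?q (s - 1 * 1) / 1 + ?q ((s + (k - 1)) - k * 1) / k
      = ?q s - (1 - 1 / k) * ?q (s - 1)"
    by (simp add: algebra_simps)
  finally show ?thesis .
qed

text \<open>
  For \<open>k \<ge> 1\<close>, the volume of the set of nonnegative points in dimension \<open>m\<close> of total load at most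
  \<open>s\<close>.  The formula expands, by the binomial theorem, the effect of \<open>m\<close> slicing steps on the
  indicator of \<open>s \<ge> 0\<close>: one step integrates from \<open>0\<close> to \<open>s\<close> and then adds \<open>- (1 - 1 / k)\<close> times
  the shift of the result by \<open>1\<close>.
\<close>

definition load_content :: "real \<Rightarrow> nat \<Rightarrow> real \<Rightarrow> real" where
  "load_content k m s =
     (\<Sum>j\<le>m. real (m choose j) * ((- (1 - 1 / k)) ^ j * truncated_power m (s - real j)))"

lemma sum_binomial_Suc:
  fixes h :: "nat \<Rightarrow> real"
  shows "(\<Sum>j\<le>Suc m. real (Suc m choose j) * h j) = (\<Sum>j\<le>m. real (m choose j) * (h j + h (Suc j)))"
proof -
  have "(\<Sum>j\<le>Suc m. real (Suc m choose j) * h j)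
      = (h 0 + (\<Sum>j\<le>m. real (m choose Suc j) * h (Suc j))) + (\<Sum>j\<le>m. real (m choose j) * h (Suc j))"
    by (subst sum.atMost_Suc_shift) (simp add: algebra_simps sum.distrib)
  also have "h 0 + (\<Sum>j\<le>m. real (m choose Suc j) * h (Suc j)) = (\<Sum>j\<le>Suc m. real (m choose j) * h j)"
    by (subst sum.atMost_Suc_shift) simp
  also have "\<dots> = (\<Sum>j\<le>m. real (m choose j) * h j)"
    by simp
  finally show ?thesis
    by (simp add: sum.distrib algebra_simps)
qed

text \<open>
  Cutting a region into slices by its last coordinate \<open>t\<close> leaves the budget \<open>s - server_load k t\<close>
  for the others, so this is the step from dimension \<open>m\<close> to dimension \<open>m + 1\<close>.
\<close>

lemma has_integral_load_content:
  assumes "1 \<le> k"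
  shows "has_bochner_integral lborel
           (\<lambda>t. indicator {0..} t * load_content k m (s - server_load k t)) (load_content k (Suc m) s)"
proof -
  define c where "c = - (1 - 1 / k)"
  let ?p = "truncated_power m" and ?q = "truncated_power (Suc m)"
  have "has_bochner_integral lborel
      (\<lambda>t. \<Sum>j\<le>m. real (m choose j) * (c ^ j * (indicator {0..} t * ?p ((s - real j) - server_load k t))))
      (\<Sum>j\<le>m. real (m choose j) * (c ^ j * (?q (s - real j) - (1 - 1 / k) * ?q (s - real j - 1))))"
    using has_integral_truncated_power_server_load[OF assms]
    by (intro has_bochner_integral_sum has_bochner_integral_mult_right) auto
  also have "(\<lambda>t. \<Sum>j\<le>m. real (m choose j) * (c ^ j * (indicator {0..} t * ?p ((s - real j) - server_load k t))))
      = (\<lambda>t. indicator {0..} t * load_content k m (s - server_load k t))"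
    by (simp add: load_content_def c_def sum_distrib_left algebra_simps)
  also have "(\<Sum>j\<le>m. real (m choose j) * (c ^ j * (?q (s - real j) - (1 - 1 / k) * ?q (s - real j - 1))))
      = (\<Sum>j\<le>m. real (m choose j) * (c ^ j * ?q (s - real j) + c ^ Suc j * ?q (s - real (Suc j))))"
    by (intro sum.cong refl) (simp add: c_def algebra_simps)
  also have "\<dots> = load_content k (Suc m) s"
    unfolding load_content_def c_def[symmetric] by (rule sum_binomial_Suc[symmetric])
  finally show ?thesis .
qed

text \<open>
  The alternating sum hides its sign, but the integral recursion shows it.  The sign is needed
  to pass between real and extended nonnegative integrals.
\<close>

lemma load_content_nonneg:
  assumes "1 \<le> k"
  shows "0 \<le> load_content k m s"
proof (induction m arbitrary: s)
  case 0
  show ?case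
    by (simp add: load_content_def truncated_power_def)
next
  case (Suc m)
  have "load_content k (Suc m) s
      = (\<integral>t. indicator {0..} t * load_content k m (s - server_load k t) \<partial>lborel)"
    by (rule has_bochner_integral_integral_eq[OF has_integral_load_content[OF assms], symmetric])
  also have "0 \<le> \<dots>"
    using Suc by (intro integral_nonneg_AE AE_I2 mult_nonneg_nonneg) auto
  finally show ?case .
qed

lemma borel_measurable_server_load [measurable]: "server_load k \<in> borel_measurable borel"
  unfolding server_load_def by measurable

lemma server_load_nonneg: "0 \<le> t \<Longrightarrow> 0 \<le> server_load k t"
  by (simp add: server_load_def)

lemma emeasure_load_region_PiM:
  fixes A :: "'a set"
  assumes "finite A" and "1 \<le> k"
  shows "emeasure (Pi\<^sub>M A (\<lambda>_. lborel))
      ({x. (\<forall>i\<in>A. 0 \<le> x i) \<and> (\<Sum>i\<in>A. server_load k (x i)) \<le> s} \<inter> space (Pi\<^sub>M A (\<lambda>_. lborel)))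
    = ennreal (load_content k (card A) s)"
  using assms(1)
proof (induction arbitrary: s rule: finite_induct)
  case empty
  show ?case
    by (auto simp: PiM_empty load_content_def truncated_power_def)
next
  case (insert b A)
  let ?M = "\<lambda>A. Pi\<^sub>M A (\<lambda>_. lborel :: real measure)"
  define S where "S A s = {x. (\<forall>i\<in>A. 0 \<le> x i) \<and> (\<Sum>i\<in>A. server_load k (x i)) \<le> s} \<inter> space (?M A)"
    for A :: "'a set" and s
  have S_sets [measurable]: "S A s \<in> sets (?M A)" if "finite A" for A s
  proof -
    have "S A s = Pi\<^sub>E A (\<lambda>_. {0..}) \<inter> (\<lambda>x. \<Sum>i\<in>A. server_load k (x i)) -` {..s} \<inter> space (?M A)"
      by (auto simp: S_def space_PiM)
    also have "\<dots> \<in> sets (?M A)"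
      using that by measurable
    finally show ?thesis .
  qed
  have slice: "indicator (S (insert b A) s) (x(b := t))
      = (indicator {0..} t * indicator (S A (s - server_load k t)) x :: ennreal)"
    if "x \<in> space (?M A)" for x t
  proof -
    have "(\<Sum>i\<in>A. server_load k ((x(b := t)) i)) = (\<Sum>i\<in>A. server_load k (x i))"
      using insert.hyps by (intro sum.cong) auto
    then have "x(b := t) \<in> S (insert b A) s \<longleftrightarrow> 0 \<le> t \<and> x \<in> S A (s - server_load k t)"
      using that insert.hyps
      by (auto simp: S_def space_PiM PiE_def extensional_def)
    then show ?thesis
      by (auto simp: indicator_def)
  qed
  interpret product_sigma_finite "\<lambda>_. lborel :: real measure"
    by standard
  have "emeasure (?M (insert b A)) (S (insert b A) s)
      = (\<integral>\<^sup>+ x. indicator (S (insert b A) s) x \<partial>?M (insert b A))"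
    using insert.hyps by (subst nn_integral_indicator) auto
  also have "\<dots> = (\<integral>\<^sup>+ t. \<integral>\<^sup>+ x. indicator (S (insert b A) s) (x(b := t)) \<partial>?M A \<partial>lborel)"
    using insert.hyps by (intro product_nn_integral_insert_rev) auto
  also have "\<dots> = (\<integral>\<^sup>+ t. \<integral>\<^sup>+ x. indicator {0..} t * indicator (S A (s - server_load k t)) x \<partial>?M A \<partial>lborel)"
    by (intro nn_integral_cong slice)
  also have "\<dots> = (\<integral>\<^sup>+ t. indicator {0..} t * emeasure (?M A) (S A (s - server_load k t)) \<partial>lborel)"
    using insert.hyps by (intro nn_integral_cong nn_integral_cmult_indicator) auto
  also have "\<dots> = (\<integral>\<^sup>+ t. ennreal (indicator {0..} t * load_content k (card A) (s - server_load k t)) \<partial>lborel)"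
    unfolding S_def insert.IH by (intro nn_integral_cong) (auto simp: indicator_def)
  also have "\<dots> = ennreal (load_content k (Suc (card A)) s)"
    using load_content_nonneg[OF assms(2)] has_integral_load_content[OF assms(2), of "card A" s]
    by (subst nn_integral_eq_integral) (auto simp: has_bochner_integral_iff)
  finally show ?case
    using insert.hyps by (simp add: S_def)
qed

lemma emeasure_load_region:
  assumes "1 \<le> k"
  shows "emeasure lborel {x :: 'a::euclidean_space. (\<forall>b\<in>Basis. 0 \<le> x \<bullet> b) \<and>
             (\<Sum>b\<in>Basis. server_load k (x \<bullet> b)) \<le> s}
           = ennreal (load_content k DIM('a) s)"
proof -
  let ?S = "{x :: 'a. (\<forall>b\<in>Basis. 0 \<le> x \<bullet> b) \<and> (\<Sum>b\<in>Basis. server_load k (x \<bullet> b)) \<le> s}"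
  have "emeasure lborel ?S
      = emeasure (distr (Pi\<^sub>M Basis (\<lambda>b. lborel)) borel (\<lambda>f. \<Sum>b\<in>Basis. f b *\<^sub>R b)) ?S"
    by (subst lborel_eq) simp
  also have "\<dots> = emeasure (Pi\<^sub>M Basis (\<lambda>b. lborel))
      ({x :: 'a \<Rightarrow> real. (\<forall>b\<in>Basis. 0 \<le> x b) \<and> (\<Sum>b\<in>Basis. server_load k (x b)) \<le> s}
        \<inter> space (Pi\<^sub>M Basis (\<lambda>b. lborel)))"
    by (subst emeasure_distr) (auto intro!: arg_cong2[where f = emeasure])
  also have "\<dots> = ennreal (load_content k DIM('a) s)"
    using assms by (intro emeasure_load_region_PiM) auto
  finally show ?thesis .
qed

text \<open>
  The region is bounded and, since the load is convex, convex.  Its frontier is therefore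
  negligible, and taking the interior does not change the measure.
\<close>

lemma vol_load_region:
  assumes "1 \<le> k"
  shows "vol {l :: real ^ 'k::finite. (\<forall>i. 0 \<le> l $ i) \<and> (\<Sum>i\<in>UNIV. server_load k (l $ i)) \<le> s}
           = load_content k CARD('k) s"
proof -
  define L where "L = {l :: real ^ 'k. (\<forall>i. 0 \<le> l $ i) \<and> (\<Sum>i\<in>UNIV. server_load k (l $ i)) \<le> s}"
  have Basis: "(Basis :: (real ^ 'k) set) = (\<lambda>i. axis i 1) ` UNIV"
    by (auto simp: Basis_vec_def)
  have L_eq: "L = {x. (\<forall>b\<in>Basis. 0 \<le> x \<bullet> b) \<and> (\<Sum>b\<in>Basis. server_load k (x \<bullet> b)) \<le> s}"
    unfolding Basis L_def by (subst sum.reindex) (auto simp: inj_on_def axis_eq_axis inner_axis)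
  have "convex L"
  proof (rule convexI)
    fix x y :: "real ^ 'k" and u v :: real
    assume xy: "x \<in> L" "y \<in> L" and uv: "0 \<le> u" "0 \<le> v" "u + v = 1"
    have "(\<Sum>i\<in>UNIV. server_load k ((u *\<^sub>R x + v *\<^sub>R y) $ i))
        \<le> (\<Sum>i\<in>UNIV. u * server_load k (x $ i) + v * server_load k (y $ i))"
    proof (rule sum_mono)
      fix i
      have "u * (x $ i) \<le> u * server_load k (x $ i)" "v * (y $ i) \<le> v * server_load k (y $ i)"
        "u * (k * x $ i - (k - 1)) \<le> u * server_load k (x $ i)"
        "v * (k * y $ i - (k - 1)) \<le> v * server_load k (y $ i)"
        using uv by (intro mult_left_mono; simp add: server_load_def)+
      moreover have "k - 1 = u * (k - 1) + v * (k - 1)"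
        using uv(3) by (metis distrib_right mult_1)
      ultimately show "server_load k ((u *\<^sub>R x + v *\<^sub>R y) $ i)
          \<le> u * server_load k (x $ i) + v * server_load k (y $ i)"
        unfolding server_load_def[of k "(u *\<^sub>R x + v *\<^sub>R y) $ i"] by (simp add: algebra_simps)
    qed
    also have "\<dots> \<le> u * s + v * s"
      using xy uv by (simp add: sum.distrib sum_distrib_left[symmetric] L_def add_mono mult_left_mono)
    also have "\<dots> = s"
      using uv(3) by (metis distrib_right mult_1)
    finally show "u *\<^sub>R x + v *\<^sub>R y \<in> L"
      using xy uv by (simp add: L_def)
  qed
  moreover have "L \<subseteq> cbox 0 (\<chi> i. s)"
  proof
    fix x assume "x \<in> L"
    then have x: "\<And>i. 0 \<le> x $ i" "(\<Sum>i\<in>UNIV. server_load k (x $ i)) \<le> s"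
      by (auto simp: L_def)
    have "x $ i \<le> s" for i
    proof -
      have "x $ i \<le> server_load k (x $ i)"
        by (simp add: server_load_def)
      also have "\<dots> \<le> (\<Sum>j\<in>UNIV. server_load k (x $ j))"
        using x(1) by (intro member_le_sum server_load_nonneg) auto
      finally show ?thesis
        using x(2) by simp
    qed
    with x(1) show "x \<in> cbox 0 (\<chi> i. s)"
      by (simp add: mem_box_cart)
  qed
  then have "bounded L"
    using bounded_cbox bounded_subset by blast
  ultimately have "vol L = measure lebesgue L"
    unfolding vol_def by (intro measure_interior negligible_convex_frontier)
  also have "L \<in> sets borel"
    unfolding L_eq by measurable
  then have "measure lebesgue L = measure lborel L"
    by (simp add: measure_completion)
  also have "\<dots> = load_content k CARD('k) s"
    using emeasure_load_region[OF assms, where 'a = "real ^ 'k"] load_content_nonneg[OF assms]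
    by (simp add: measure_def L_eq)
  finally show ?thesis
    by (simp add: L_def)
qed

section \<open>The volume of the service rate region\<close>

theorem theorem6p5:
  fixes G :: "'a::{finite,field} ^ 'n::{finite,linorder} ^ 3"
    and q n :: nat
  assumes "primepow q" and "CARD('a) = q"
    and "CARD('n) = n"
    and "systematic G" and "MDS_matrix G"
    and "n \<ge> 6"
  shows "vol (service_rate_region G)
           = (real n ^ 3 + 18 * real n ^ 2 + 54 * real n - 18) / 162"
proof -
  have "vol (service_rate_region G) = load_content 3 3 (real n)"
    using service_rate_region_systematic_MDS[OF assms(4,5)]
      vol_load_region[of 3 "real n", where 'k = 3] assms(3,6) by simp
  \<comment> \<open>The terms \<open>j = 0, ..., 3\<close> of the binomial expansion with \<open>- (1 - 1 / k) = - 2 / 3\<close>.\<close>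
  also have "\<dots> = (real n ^ 3 - 2 * (real n - 1) ^ 3 + 4 / 3 * (real n - 2) ^ 3
      - 8 / 27 * (real n - 3) ^ 3) / 6"
    using assms(6)
    by (simp add: load_content_def truncated_power_def eval_nat_numeral)
  also have "\<dots> = (real n ^ 3 + 18 * real n ^ 2 + 54 * real n - 18) / 162"
    by (simp add: field_simps power2_eq_square power3_eq_cube)
  finally show ?thesis .
qed

end
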